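(* Let $Q$ be a real-valued function on $\mathbf{R}$. If $Q(x)-\frac{\rho}{2}x^2$ is convex on $\mathbf{R}$ with a constant $\rho>0$, then $$W(\mu,\mu_Q)\le\sqrt{\frac{1}{\rho}\,\widetilde{\Sigma}_Q(\mu)}$$ for every compactly supported Borel probability measure $\mu$ on $\mathbf{R}$.
   Context: $\mathcal{M}(\mathbf{R})$ is the set of Borel probability measures on $\mathbf{R}$. Wasserstein distance: for $\mu,\nu\in\mathcal{M}(\mathbf{R})$, $$W(\mu,\nu):=\inf_{\pi\in\Pi(\mu,\nu)}\sqrt{\iint_{\mathbf{R}\times\mathbf{R}}\tfrac12(x-y)^2\,d\pi(x,y)},$$ where $\Pi(\mu,\nu)$ is the set of probability measures on $\mathbf{R}\times\mathbf{R}$ with marginals $\mu$ and $\nu$ (note the factor $\frac12$). Free entropy: $\Sigma(\mu):=\iint_{\mathbf{R}^2}\log|x-y|\,d\mu(x)\,d\mu(y)$. For a real-valued continuous $Q$ on $\mathbf{R}$ with $\lim_{|x|\to\infty}|x|\exp(-\varepsilon Q(x))=0$ for every $\varepsilon>0$ (automatic under the convexity hypothesis of the claim), the weighted energy $E_Q(\mu):=-\Sigma(\mu)+\int_{\mathbf{R}}Q\,d\mu$ has a unique minimizer $\mu_Q\in\mathcal{M}(\mathbf{R})$ (the equilibrium measure associated with $Q$), which is compactly supported and has $E_Q(\mu_Q)$ finite. Put $B(Q):=-E_Q(\mu_Q)$. The relative free entropy is $$\widetilde{\Sigma}_Q(\mu):=-\Sigma(\mu)+\int_{\mathbf{R}}Q(x)\,d\mu(x)+B(Q).$$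 *)

theory Defs
  imports "HOL-Probability.Probability"
begin

definition borel_probs :: "'a::topological_space measure set" where
  "borel_probs = {\<mu>. prob_space \<mu> \<and> sets \<mu> = sets borel}"

definition measure_support :: "'a::topological_space measure \<Rightarrow> 'a set" where
  "measure_support \<mu> = {x. \<forall>U. open U \<longrightarrow> x \<in> U \<longrightarrow> emeasure \<mu> U > 0}"

definition compactly_supported :: "'a::topological_space measure \<Rightarrow> bool" where
  "compactly_supported \<mu> \<longleftrightarrow> compact (measure_support \<mu>)"

(* Meaningful for nonnegative arguments only. *)
definition ereal_sqrt :: "ereal \<Rightarrow> ereal" where
  "ereal_sqrt x = (if x = \<infinity> then \<infinity> else ereal (sqrt (real_of_ereal x)))"

definition couplings :: "real measure \<Rightarrow> real measure \<Rightarrow> (real \<times> real) measure set" where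
  "couplings \<mu> \<nu> = {\<pi> \<in> borel_probs. distr \<pi> borel fst = \<mu> \<and> distr \<pi> borel snd = \<nu>}"

definition wasserstein :: "real measure \<Rightarrow> real measure \<Rightarrow> ereal" where
  "wasserstein \<mu> \<nu> =
     (INF \<pi>\<in>couplings \<mu> \<nu>.
        ereal_sqrt (enn2ereal (\<integral>\<^sup>+ p. ennreal (1/2 * (fst p - snd p)\<^sup>2) \<partial>\<pi>)))"

(* Positive part minus negative part, the Lebesgue integral with values in the extended reals.
   Since \<infinity> - \<infinity> = \<infinity> for ereal, the value is \<infinity> whenever the positive part has infinite
   integral. *)
definition ereal_integral :: "'a measure \<Rightarrow> ('a \<Rightarrow> ereal) \<Rightarrow> ereal" where
  "ereal_integral M f =
     enn2ereal (\<integral>\<^sup>+ x. e2ennreal (f x) \<partial>M) - enn2ereal (\<integral>\<^sup>+ x. e2ennreal (- f x) \<partial>M)"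

(* The logarithm on [0, \<infinity>) with log 0 = -\<infinity>; the library convention ln 0 = 0 would
   ignore atoms of the measure. *)
definition ereal_log :: "real \<Rightarrow> ereal" where
  "ereal_log t = (if t = 0 then -\<infinity> else ereal (ln t))"

definition free_entropy :: "real measure \<Rightarrow> ereal" where
  "free_entropy \<mu> = ereal_integral (\<mu> \<Otimes>\<^sub>M \<mu>) (\<lambda>p. ereal_log \<bar>fst p - snd p\<bar>)"

(* If log|x-y| has an infinite positive part under the product measure, then free_entropy \<mu> = \<infinity>.
   When |x| exp(-\<epsilon> Q x) tends to 0 for all \<epsilon> > 0, Q is bounded below and dominates log|x|,
   so the integral of Q is then \<infinity> too, and the sum below is -\<infinity> + \<infinity> = \<infinity> in ereal. This
   agrees with the integral of the lower bounded kernel -log|x-y| + (Q x + Q y)/2. *)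
definition weighted_energy :: "(real \<Rightarrow> real) \<Rightarrow> real measure \<Rightarrow> ereal" where
  "weighted_energy Q \<mu> = - free_entropy \<mu> + ereal_integral \<mu> (\<lambda>x. ereal (Q x))"

(* The unique minimizer of the weighted energy over all Borel probability measures;
   an unspecified value for those Q for which there is no unique minimizer. *)
definition equilibrium_measure :: "(real \<Rightarrow> real) \<Rightarrow> real measure" where
  "equilibrium_measure Q =
     (THE \<mu>. \<mu> \<in> borel_probs \<and> (\<forall>\<nu>\<in>borel_probs. weighted_energy Q \<mu> \<le> weighted_energy Q \<nu>))"

definition energy_constant :: "(real \<Rightarrow> real) \<Rightarrow> ereal" where
  "energy_constant Q = - weighted_energy Q (equilibrium_measure Q)"

definition rel_free_entropy :: "(real \<Rightarrow> real) \<Rightarrow> real measure \<Rightarrow> ereal" where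
  "rel_free_entropy Q \<mu> =
     - free_entropy \<mu> + ereal_integral \<mu> (\<lambda>x. ereal (Q x)) + energy_constant Q"

end

theory Submission
  imports Defs
begin

text \<open>
  On the line, a probability measure \<open>\<nu>\<close> is the law of its quantile function, a nondecreasing
  function \<open>X\<close> on \<open>(0, 1)\<close>. Take two measures with quantile functions \<open>X\<close> and \<open>Y\<close>, and move one to
  the other along the laws of \<open>(1 - \<theta>) X + \<theta> Y\<close>. As \<open>X\<close> and \<open>Y\<close> are both nondecreasing,
  \<open>\<bar>X s - X t\<bar>\<close> is replaced by the convex combination of \<open>\<bar>X s - X t\<bar>\<close> and \<open>\<bar>Y s - Y t\<bar>\<close>, so
  convexity of \<open>- log\<close> makes the logarithmic energy convex along this path. The potential
  contributes its modulus of convexity \<open>\<rho>\<close>. Hence, with \<open>d = \<integral> (X - Y)\<^sup>2 / 2\<close> and \<open>E\<close> the weighted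
  energy, lemma \<open>kernel_energy_displacement_convex\<close>:

    \<open>E \<theta> + \<rho> \<theta> (1 - \<theta>) d \<le> (1 - \<theta>) E 0 + \<theta> E 1\<close>.

  If the path starts at the minimizer then \<open>E 0 \<le> E \<theta>\<close>; dividing by \<open>\<theta>\<close> and letting \<open>\<theta> \<rightarrow> 0\<close>
  gives \<open>\<rho> d \<le> E 1 - E 0\<close> (lemma \<open>kernel_energy_minimizer_gap\<close>). The right-hand side is the
  relative free entropy, and \<open>(X, Y)\<close> is a coupling, so \<open>d\<close> bounds the squared Wasserstein distance.

  The equilibrium measure is defined as the unique minimizer, so its existence and uniqueness have to
  be shown as well, and the same inequality gives both. Two minimizers have \<open>d = 0\<close>. At
  \<open>\<theta> = 1 / 2\<close> it says that the quantile functions of a minimizing sequence are Cauchy in \<open>L\<^sup>2(0, 1)\<close>,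
  whence they converge almost everywhere along a fast subsequence; Fatou's lemma applied to the
  nonnegative, lower semicontinuous kernel shows that the law of the limit is a minimizer (lemma
  \<open>kernel_energy_minimizer_exists\<close>).
  This needs one measure of finite energy, and \<open>\<mu>\<close> itself will do: if its energy is infinite,
  then so is the right-hand side of the claim.

  Throughout, the energy is the double integral of one \<open>[0, \<infinity>]\<close>-valued kernel,
  \<open>(V x + V y) / 2 - log \<bar>x - y\<bar>\<close> with \<open>V = Q + c\<close>. Lemma \<open>weighted_energy_eq_kernel_energy\<close>
  reconciles this with the definition by separate integrals of \<open>log\<close> and \<open>Q\<close>.
\<close>

section \<open>The logarithmic kernel of a confining potential\<close>

text \<open>
  The diagonal is singled out because \<open>ln 0 = 0\<close>; with the value \<open>\<infinity>\<close> atoms have infinite energy.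
\<close>

definition log_kernel :: "(real \<Rightarrow> real) \<Rightarrow> real \<Rightarrow> real \<Rightarrow> ennreal" where
  "log_kernel V x y = (if x = y then \<infinity> else ennreal ((V x + V y) / 2 - ln \<bar>x - y\<bar>))"

definition kernel_energy :: "(real \<Rightarrow> real) \<Rightarrow> real measure \<Rightarrow> ennreal" where
  "kernel_energy V \<nu> = (\<integral>\<^sup>+ x. \<integral>\<^sup>+ y. log_kernel V x y \<partial>\<nu> \<partial>\<nu>)"

text \<open>
  A supporting line of the convex part at \<open>0\<close> shows that \<open>Q\<close> grows quadratically; the constant
  \<open>c\<close> then comes from completing the square. The factor \<open>4\<close> is the one in \<open>confining_potential\<close>.
\<close>

lemma strongly_convex_coercive:
  fixes Q :: "real \<Rightarrow> real"
  assumes \<rho>: "\<rho> > 0" and convex: "convex_on UNIV (\<lambda>x. Q x - \<rho> / 2 * x\<^sup>2)"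
  obtains c where "\<And>x. 4 * \<bar>x\<bar> \<le> Q x + c"
proof -
  define g where "g = (\<lambda>x. Q x - \<rho> / 2 * x\<^sup>2)"
  define a where "a = Inf ((\<lambda>t. (g 0 - g t) / (0 - t)) ` ({0<..} \<inter> UNIV))"
  have g_ge: "g x \<ge> g 0 + a * x" for x
    using convex_le_Inf_differential[of UNIV g 0 x] convex by (simp add: a_def g_def)
  have Q_ge: "Q x \<ge> \<rho> / 2 * x\<^sup>2 + a * x + Q 0" for x
    using g_ge[of x] by (simp add: g_def)
  show thesis
  proof (rule that)
    fix x :: real
    have "4 * \<bar>x\<bar> - a * x \<le> (4 + \<bar>a\<bar>) * \<bar>x\<bar>"
      using abs_ge_minus_self[of "a * x"] by (simp add: abs_mult algebra_simps)
    also have "\<dots> \<le> \<rho> / 2 * x\<^sup>2 + (4 + \<bar>a\<bar>)\<^sup>2 / (2 * \<rho>)"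
    proof -
      have "0 \<le> (\<rho> * \<bar>x\<bar> - (4 + \<bar>a\<bar>))\<^sup>2 / (2 * \<rho>)"
        using \<rho> by simp
      also have "\<dots> = \<rho> / 2 * x\<^sup>2 + (4 + \<bar>a\<bar>)\<^sup>2 / (2 * \<rho>) - (4 + \<bar>a\<bar>) * \<bar>x\<bar>"
        using \<rho> by (simp add: field_simps power2_eq_square)
      finally show ?thesis by simp
    qed
    finally show "4 * \<bar>x\<bar> \<le> Q x + ((4 + \<bar>a\<bar>)\<^sup>2 / (2 * \<rho>) - Q 0)"
      using Q_ge[of x] by linarith
  qed
qed

lemma strongly_convex_ineq:
  fixes Q :: "real \<Rightarrow> real"
  assumes convex: "convex_on UNIV (\<lambda>x. Q x - \<rho> / 2 * x\<^sup>2)" and \<theta>: "0 \<le> \<theta>" "\<theta> \<le> 1"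
  shows "Q ((1 - \<theta>) * a + \<theta> * b) + \<rho> / 2 * (\<theta> * (1 - \<theta>)) * (a - b)\<^sup>2 \<le> (1 - \<theta>) * Q a + \<theta> * Q b"
proof -
  have "Q ((1 - \<theta>) * a + \<theta> * b) - \<rho> / 2 * ((1 - \<theta>) * a + \<theta> * b)\<^sup>2
      \<le> (1 - \<theta>) * (Q a - \<rho> / 2 * a\<^sup>2) + \<theta> * (Q b - \<rho> / 2 * b\<^sup>2)"
    using convex_onD[OF convex \<theta>, of a b] by simp
  moreover have "(1 - \<theta>) * (\<rho> / 2 * a\<^sup>2) + \<theta> * (\<rho> / 2 * b\<^sup>2) - \<rho> / 2 * ((1 - \<theta>) * a + \<theta> * b)\<^sup>2
      = \<rho> / 2 * (\<theta> * (1 - \<theta>)) * (a - b)\<^sup>2"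
    by (simp add: field_simps power2_eq_square)
  ultimately show ?thesis
    unfolding right_diff_distrib[of "1 - \<theta>" "Q a"] right_diff_distrib[of \<theta> "Q b"] by linarith
qed

text \<open>
  The factor \<open>4\<close> makes \<open>log \<bar>x - y\<bar> \<le> \<bar>x\<bar> + \<bar>y\<bar> \<le> (V x + V y) / 4\<close>, so that subtracting the
  logarithm from \<open>(V x + V y) / 2\<close> leaves at least \<open>(V x + V y) / 4\<close>. The kernel is therefore
  nonnegative, and infinite \<open>\<integral> V\<close> forces infinite energy.
\<close>

locale confining_potential =
  fixes V :: "real \<Rightarrow> real"
  assumes continuous_V: "continuous_on UNIV V"
    and abs_le_V: "\<And>x. 4 * \<bar>x\<bar> \<le> V x"
begin

lemma V_nonneg: "0 \<le> V x"
  using abs_le_V[of x] by linarith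

lemma measurable_V [measurable]: "V \<in> borel_measurable borel"
  using continuous_V by (rule borel_measurable_continuous_onI)

lemma measurable_log_kernel [measurable]:
  "(\<lambda>p. log_kernel V (fst p) (snd p)) \<in> borel_measurable (borel \<Otimes>\<^sub>M borel)"
  unfolding log_kernel_def by measurable

lemma measurable_log_kernel_comp [measurable]:
  assumes "f \<in> borel_measurable M" "g \<in> borel_measurable M"
  shows "(\<lambda>x. log_kernel V (f x) (g x)) \<in> borel_measurable M"
  using measurable_compose[OF measurable_Pair[OF assms] measurable_log_kernel] by simp

lemma max_ln_le_V: "max 0 (ln \<bar>x - y\<bar>) \<le> (V x + V y) / 4"
proof (cases "x = y")
  case True
  then show ?thesis using V_nonneg[of y] by simp
next
  case False
  then have "ln \<bar>x - y\<bar> \<le> \<bar>x - y\<bar>"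
    using ln_le_minus_one[of "\<bar>x - y\<bar>"] by simp
  also have "\<dots> \<le> (V x + V y) / 4"
    using abs_triangle_ineq4[of x y] abs_le_V[of x] abs_le_V[of y] by (simp add: field_simps)
  finally show ?thesis
    using V_nonneg[of x] V_nonneg[of y] by simp
qed

text \<open>
  The kernel is even continuous into \<open>[0, \<infinity>]\<close>: at the diagonal its value \<open>\<infinity>\<close> is the limit of
  \<open>- log\<close>, as \<open>V\<close> is nonnegative. The semicontinuous form is what Fatou's lemma consumes.
\<close>

lemma lower_semicontinuous_log_kernel:
  assumes x: "x \<longlonglongrightarrow> a" and y: "y \<longlonglongrightarrow> b"
  shows "log_kernel V a b \<le> liminf (\<lambda>n. log_kernel V (x n) (y n))"
proof -
  have "(\<lambda>n. log_kernel V (x n) (y n)) \<longlonglongrightarrow> log_kernel V a b"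
  proof (cases "a = b")
    case True
    have "\<forall>\<^sub>F n in sequentially. ennreal r < log_kernel V (x n) (y n)" if r: "r \<ge> 0" for r
    proof -
      have "(\<lambda>n. \<bar>x n - y n\<bar>) \<longlonglongrightarrow> \<bar>a - b\<bar>"
        by (intro tendsto_intros x y)
      then have "\<forall>\<^sub>F n in sequentially. \<bar>x n - y n\<bar> < exp (- r)"
        using True by (intro order_tendstoD(2)) auto
      then show ?thesis
      proof eventually_elim
        case (elim n)
        show ?case
        proof (cases "x n = y n")
          case False
          then have "ln \<bar>x n - y n\<bar> < ln (exp (- r))"
            using elim by (subst ln_less_cancel_iff) auto
          then have "r < (V (x n) + V (y n)) / 2 - ln \<bar>x n - y n\<bar>"
            using V_nonneg[of "x n"] V_nonneg[of "y n"] by (simp add: field_simps)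
          then show ?thesis
            using False r by (simp add: log_kernel_def ennreal_less_iff)
        qed (simp add: log_kernel_def)
      qed
    qed
    then show ?thesis
      using True by (simp add: log_kernel_def tendsto_top_iff_ennreal)
  next
    case False
    have V_tendsto: "(\<lambda>n. V (u n)) \<longlonglongrightarrow> V l" if "u \<longlonglongrightarrow> l" for u l
      using continuous_on_tendsto_compose[OF continuous_V that] by simp
    have "(\<lambda>n. ennreal ((V (x n) + V (y n)) / 2 - ln \<bar>x n - y n\<bar>))
        \<longlonglongrightarrow> ennreal ((V a + V b) / 2 - ln \<bar>a - b\<bar>)"
      using False by (intro tendsto_ennrealI tendsto_intros x y V_tendsto) auto
    moreover have "\<forall>\<^sub>F n in sequentially. x n - y n \<noteq> 0"
      using False by (intro tendsto_imp_eventually_ne[of _ "a - b"] tendsto_intros x y) auto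
    then have "\<forall>\<^sub>F n in sequentially.
        ennreal ((V (x n) + V (y n)) / 2 - ln \<bar>x n - y n\<bar>) = log_kernel V (x n) (y n)"
      by eventually_elim (simp add: log_kernel_def)
    ultimately have "(\<lambda>n. log_kernel V (x n) (y n)) \<longlonglongrightarrow> ennreal ((V a + V b) / 2 - ln \<bar>a - b\<bar>)"
      by (rule Lim_transform_eventually)
    then show ?thesis
      using False by (simp add: log_kernel_def)
  qed
  then show ?thesis
    by (simp add: lim_imp_Liminf)
qed

text \<open>
  The singular part \<open>log\<^sup>-\<close> may have infinite integral; the remaining part only involves \<open>V\<close> and
  \<open>log\<^sup>+ \<le> (V x + V y) / 4\<close>, and is nonnegative.
\<close>

lemma log_kernel_eq_plus:
  "log_kernel V x y = e2ennreal (- ereal_log \<bar>x - y\<bar>)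
     + ennreal ((V x + V y) / 2 - max 0 (ln \<bar>x - y\<bar>))"
proof (cases "x = y")
  case False
  let ?v = "(V x + V y) / 2" and ?l = "ln \<bar>x - y\<bar>"
  have "?v - max 0 ?l \<ge> 0"
    using max_ln_le_V[of x y] V_nonneg[of x] V_nonneg[of y] by argo
  then have "ennreal (- ?l) + ennreal (?v - max 0 ?l) = ennreal (max 0 (- ?l) + (?v - max 0 ?l))"
    by (subst ennreal_plus) (simp_all add: ennreal_max_0)
  also have "max 0 (- ?l) + (?v - max 0 ?l) = ?v - ?l"
    by (simp add: max_def)
  finally show ?thesis
    using False by (simp add: log_kernel_def ereal_log_def)
qed (simp add: log_kernel_def ereal_log_def)

lemma measurable_ereal_log [measurable]: "ereal_log \<in> borel_measurable borel"
  unfolding ereal_log_def by measurable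

text \<open>
  If \<open>\<integral> V = \<infinity>\<close>, both sides are \<open>\<infinity>\<close>: on the left because \<open>\<infinity>\<close> absorbs \<open>-\<infinity>\<close> in sums of
  extended reals, on the right by the lower bound \<open>(V x + V y) / 4\<close> of the regular part of the
  kernel. If \<open>\<integral> V < \<infinity>\<close>, every integral except the one of \<open>log\<^sup>-\<close> is finite, so the
  integrals of \<open>log\<^sup>+\<close>, \<open>log\<^sup>-\<close> and \<open>V\<close> can be regrouped freely.
\<close>

lemma weighted_energy_eq_kernel_energy:
  fixes c :: real
  assumes \<nu>: "\<nu> \<in> borel_probs" and c: "0 \<le> c"
  shows "weighted_energy (\<lambda>x. V x - c) \<nu> = enn2ereal (kernel_energy V \<nu>) - ereal c"
proof -
  interpret prob_space \<nu>
    using \<nu> by (simp add: borel_probs_def)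
  have [measurable_cong, simp]: "sets \<nu> = sets borel"
    using \<nu> by (simp add: borel_probs_def)
  interpret pair: pair_prob_space \<nu> \<nu> ..
  define A where "A = (\<integral>\<^sup>+ x. ennreal (V x / 2) \<partial>\<nu>)"
  define L where "L = (\<integral>\<^sup>+ x. \<integral>\<^sup>+ y. ennreal (ln \<bar>x - y\<bar>) \<partial>\<nu> \<partial>\<nu>)"
  define N where "N = (\<integral>\<^sup>+ x. \<integral>\<^sup>+ y. e2ennreal (- ereal_log \<bar>x - y\<bar>) \<partial>\<nu> \<partial>\<nu>)"
  define G where "G = (\<integral>\<^sup>+ x. \<integral>\<^sup>+ y. ennreal ((V x + V y) / 2 - max 0 (ln \<bar>x - y\<bar>)) \<partial>\<nu> \<partial>\<nu>)"
  define Qp where "Qp = (\<integral>\<^sup>+ x. ennreal (V x - c) \<partial>\<nu>)"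
  define Qm where "Qm = (\<integral>\<^sup>+ x. ennreal (c - V x) \<partial>\<nu>)"
  have log_measurable: "(\<lambda>p. e2ennreal (ereal_log \<bar>fst p - snd p\<bar>)) \<in> borel_measurable (\<nu> \<Otimes>\<^sub>M \<nu>)"
    "(\<lambda>p. e2ennreal (- ereal_log \<bar>fst p - snd p\<bar>)) \<in> borel_measurable (\<nu> \<Otimes>\<^sub>M \<nu>)"
    by measurable
  have log_pos: "e2ennreal (ereal_log \<bar>x - y\<bar>) = ennreal (ln \<bar>x - y\<bar>)" for x y
    by (simp add: ereal_log_def e2ennreal_neg)
  have \<Sigma>: "free_entropy \<nu> = enn2ereal L - enn2ereal N"
    unfolding free_entropy_def ereal_integral_def L_def N_def
    using nn_integral_fst[OF log_measurable(1)] nn_integral_fst[OF log_measurable(2)]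
    by (simp add: log_pos)
  have Q: "ereal_integral \<nu> (\<lambda>x. ereal (V x - c)) = enn2ereal Qp - enn2ereal Qm"
    by (simp add: ereal_integral_def Qp_def Qm_def)
  have energy: "kernel_energy V \<nu> = N + G"
    unfolding kernel_energy_def N_def G_def log_kernel_eq_plus
    by (simp add: nn_integral_add)
  \<comment> \<open>\<open>A + A\<close> is \<open>\<integral> V\<close>; the halves match the two arguments of the kernel.\<close>
  have AA: "A + A = G + L"
  proof -
    have "A + A = (\<integral>\<^sup>+ x. \<integral>\<^sup>+ y. ennreal (V x / 2) + ennreal (V y / 2) \<partial>\<nu> \<partial>\<nu>)"
      by (simp add: nn_integral_add A_def emeasure_space_1)
    also have "\<dots> = (\<integral>\<^sup>+ x. \<integral>\<^sup>+ y. ennreal ((V x + V y) / 2 - max 0 (ln \<bar>x - y\<bar>))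
        + ennreal (ln \<bar>x - y\<bar>) \<partial>\<nu> \<partial>\<nu>)"
    proof (intro nn_integral_cong)
      fix x y
      have "(V x + V y) / 2 - max 0 (ln \<bar>x - y\<bar>) \<ge> 0"
        using max_ln_le_V[of x y] V_nonneg[of x] V_nonneg[of y] by argo
      then have "ennreal ((V x + V y) / 2 - max 0 (ln \<bar>x - y\<bar>)) + ennreal (max 0 (ln \<bar>x - y\<bar>))
          = ennreal ((V x + V y) / 2)"
        by (subst ennreal_plus[symmetric]) auto
      then show "ennreal (V x / 2) + ennreal (V y / 2)
          = ennreal ((V x + V y) / 2 - max 0 (ln \<bar>x - y\<bar>)) + ennreal (ln \<bar>x - y\<bar>)"
        using V_nonneg[of x] V_nonneg[of y]
        by (simp add: ennreal_max_0 add_divide_distrib flip: ennreal_plus)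
    qed
    also have "\<dots> = G + L"
      by (simp add: nn_integral_add G_def L_def)
    finally show ?thesis .
  qed
  have "A \<le> G"
  proof -
    have "A = (\<integral>\<^sup>+ x. ennreal (V x / 4) \<partial>\<nu>) + (\<integral>\<^sup>+ x. ennreal (V x / 4) \<partial>\<nu>)"
      unfolding A_def using V_nonneg by (simp flip: nn_integral_add ennreal_plus)
    also have "\<dots> = (\<integral>\<^sup>+ x. \<integral>\<^sup>+ y. ennreal (V x / 4) + ennreal (V y / 4) \<partial>\<nu> \<partial>\<nu>)"
      by (simp add: nn_integral_add emeasure_space_1)
    also have "\<dots> \<le> G"
      unfolding G_def
    proof (intro nn_integral_mono)
      fix x y
      show "ennreal (V x / 4) + ennreal (V y / 4)
          \<le> ennreal ((V x + V y) / 2 - max 0 (ln \<bar>x - y\<bar>))"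
        using max_ln_le_V[of x y] V_nonneg[of x] V_nonneg[of y]
        by (subst ennreal_plus[symmetric]) (auto intro!: ennreal_leI simp: field_simps)
    qed
    finally show ?thesis .
  qed
  have "Qp + ennreal c = (A + A) + Qm"
  proof -
    have "Qp + ennreal c = (\<integral>\<^sup>+ x. ennreal (V x - c) + ennreal c \<partial>\<nu>)"
      by (simp add: nn_integral_add Qp_def emeasure_space_1)
    also have "\<dots> = (\<integral>\<^sup>+ x. (ennreal (V x / 2) + ennreal (V x / 2)) + ennreal (c - V x) \<partial>\<nu>)"
    proof (intro nn_integral_cong)
      fix x
      show "ennreal (V x - c) + ennreal c = (ennreal (V x / 2) + ennreal (V x / 2)) + ennreal (c - V x)"
        using V_nonneg[of x] c by (cases "c \<le> V x") (simp_all add: ennreal_neg flip: ennreal_plus)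
    qed
    also have "\<dots> = (A + A) + Qm"
      by (simp add: nn_integral_add A_def Qm_def)
    finally show ?thesis .
  qed
  moreover have "Qm \<noteq> \<infinity>"
  proof -
    have "Qm \<le> (\<integral>\<^sup>+ x. ennreal c \<partial>\<nu>)"
      unfolding Qm_def using V_nonneg by (intro nn_integral_mono ennreal_leI) simp
    then show ?thesis by (auto simp: emeasure_space_1 top_unique)
  qed
  ultimately show ?thesis
  proof (cases "A = \<infinity>")
    case True
    have "Qp = \<infinity>"
      using \<open>Qp + ennreal c = (A + A) + Qm\<close> True by (cases Qp) (auto simp: ennreal_plus[symmetric] simp del: ennreal_plus)
    moreover have "kernel_energy V \<nu> = \<infinity>"
      using energy \<open>A \<le> G\<close> True by (simp add: top_unique)
    ultimately show ?thesis
      by (simp add: weighted_energy_def Q)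
  next
    case False
    then obtain a where a: "A = ennreal a" "a \<ge> 0" by (cases A) auto
    obtain qm where qm: "Qm = ennreal qm" "qm \<ge> 0" using \<open>Qm \<noteq> \<infinity>\<close> by (cases Qm) auto
    obtain qp where qp: "Qp = ennreal qp" "qp \<ge> 0"
      using \<open>Qp + ennreal c = (A + A) + Qm\<close> a qm by (cases Qp) (auto simp: ennreal_plus[symmetric] simp del: ennreal_plus)
    have "qp + c = a + a + qm"
      using \<open>Qp + ennreal c = (A + A) + Qm\<close> a qm qp c by (simp flip: ennreal_plus)
    obtain g l where gl: "G = ennreal g" "g \<ge> 0" "L = ennreal l" "l \<ge> 0"
      using AA a by (cases G; cases L) (auto simp: ennreal_plus[symmetric] simp del: ennreal_plus)
    have "a + a = g + l"
      using AA a gl by (simp flip: ennreal_plus)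
    show ?thesis
    proof (cases N)
      case (real n)
      then have "enn2ereal (N + G) = ereal (n + g)"
        using gl by (simp flip: ennreal_plus)
      then show ?thesis
        using real gl qp qm \<open>a + a = g + l\<close> \<open>qp + c = a + a + qm\<close>
        by (simp add: weighted_energy_def Q \<Sigma> energy)
    next
      case top
      then show ?thesis
        using gl qp qm by (simp add: weighted_energy_def Q \<Sigma> energy)
    qed
  qed
qed

end

section \<open>Quantile functions and couplings\<close>

abbreviation unit_interval_measure :: "real measure" where
  "unit_interval_measure \<equiv> restrict_space lborel {0<..<1}"

lemma prob_space_unit_interval: "prob_space unit_interval_measure"
  by (auto simp: emeasure_restrict_space space_restrict_space intro!: prob_spaceI)

lemma quantile_function:
  fixes \<nu> :: "real measure"
  assumes "\<nu> \<in> borel_probs"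
  obtains X where "X \<in> borel_measurable unit_interval_measure" "mono_on {0<..<1} X"
    "distr unit_interval_measure borel X = \<nu>"
proof -
  interpret cdf_distribution \<nu>
    using assms by (auto simp: borel_probs_def cdf_distribution_def real_distribution_def
        real_distribution_axioms_def)
  show thesis
    by (rule that[OF _ mono_I distr_I_eq_M])
       (use measurable_CI in \<open>simp cong: measurable_cong_sets add: sets_restrict_space\<close>)
qed

lemma distr_in_borel_probs:
  assumes "prob_space M" "X \<in> M \<rightarrow>\<^sub>M borel"
  shows "distr M borel X \<in> borel_probs"
  using assms by (simp add: borel_probs_def prob_space.prob_space_distr)

lemma ereal_sqrt_mono:
  assumes "0 \<le> a" "a \<le> b"
  shows "ereal_sqrt a \<le> ereal_sqrt b"
  using assms by (cases a; cases b) (auto simp: ereal_sqrt_def)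

text \<open>
  Two random variables on a common probability space are a coupling of their laws.
\<close>

lemma wasserstein_le_transport_cost:
  fixes M :: "'a measure"
  assumes M: "prob_space M" and X [measurable]: "X \<in> borel_measurable M"
    and Y [measurable]: "Y \<in> borel_measurable M"
  shows "wasserstein (distr M borel X) (distr M borel Y)
    \<le> ereal_sqrt (enn2ereal (\<integral>\<^sup>+ s. ennreal (1 / 2 * (X s - Y s)\<^sup>2) \<partial>M))"
proof -
  let ?\<pi> = "distr M (borel :: (real \<times> real) measure) (\<lambda>s. (X s, Y s))"
  have XY [measurable]: "(\<lambda>s. (X s, Y s)) \<in> M \<rightarrow>\<^sub>M borel"
    by (simp add: borel_prod[symmetric])
  have "?\<pi> \<in> couplings (distr M borel X) (distr M borel Y)"
    using distr_in_borel_probs[OF M XY]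
    by (simp add: couplings_def distr_distr comp_def borel_prod[symmetric])
  moreover have "(\<integral>\<^sup>+ p. ennreal (1 / 2 * (fst p - snd p)\<^sup>2) \<partial>?\<pi>)
      = (\<integral>\<^sup>+ s. ennreal (1 / 2 * (X s - Y s)\<^sup>2) \<partial>M)"
    by (subst nn_integral_distr) (simp_all add: borel_prod[symmetric])
  ultimately show ?thesis
    unfolding wasserstein_def by (metis (no_types, lifting) INF_lower)
qed

text \<open>
  The telescoping argument behind the completeness of \<open>L\<^sup>1\<close>.
\<close>

lemma AE_convergent_if_summable_increments:
  fixes X :: "nat \<Rightarrow> 'a \<Rightarrow> real"
  assumes [measurable]: "\<And>n. X n \<in> borel_measurable M"
    and fin: "(\<Sum>n. \<integral>\<^sup>+ s. ennreal \<bar>X (Suc n) s - X n s\<bar> \<partial>M) \<noteq> \<infinity>"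
  shows "AE s in M. convergent (\<lambda>n. X n s)"
proof -
  have "(\<integral>\<^sup>+ s. (\<Sum>n. ennreal \<bar>X (Suc n) s - X n s\<bar>) \<partial>M) \<noteq> \<infinity>"
    using fin by (subst nn_integral_suminf) auto
  then have "AE s in M. (\<Sum>n. ennreal \<bar>X (Suc n) s - X n s\<bar>) \<noteq> \<infinity>"
    by (intro nn_integral_noteq_infinite) auto
  then show ?thesis
  proof eventually_elim
    case (elim s)
    then have "summable (\<lambda>n. \<bar>X (Suc n) s - X n s\<bar>)"
      by (intro summable_suminf_not_top) auto
    then have "summable (\<lambda>n. X (Suc n) s - X n s)"
      by (rule summable_rabs_cancel)
    then have "convergent (\<lambda>n. X 0 s + (\<Sum>i<n. X (Suc i) s - X i s))"
      by (intro convergent_add convergent_const) (simp add: summable_iff_convergent)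
    then show "convergent (\<lambda>n. X n s)"
      using sum_lessThan_telescope[of "\<lambda>n. X n s"] by simp
  qed
qed

section \<open>Displacement convexity\<close>

context confining_potential
begin

lemma kernel_energy_distr:
  assumes M: "prob_space M" and X [measurable]: "X \<in> borel_measurable M"
  shows "kernel_energy V (distr M borel X) = (\<integral>\<^sup>+ s. \<integral>\<^sup>+ t. log_kernel V (X s) (X t) \<partial>M \<partial>M)"
proof -
  interpret M: prob_space M by fact
  interpret D: prob_space "distr M borel X" by (rule M.prob_space_distr) fact
  have "kernel_energy V (distr M borel X)
      = (\<integral>\<^sup>+ s. \<integral>\<^sup>+ y. log_kernel V (X s) y \<partial>distr M borel X \<partial>M)"
    unfolding kernel_energy_def by (rule nn_integral_distr) simp_all
  also have "\<dots> = (\<integral>\<^sup>+ s. \<integral>\<^sup>+ t. log_kernel V (X s) (X t) \<partial>M \<partial>M)"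
    by (simp add: nn_integral_distr)
  finally show ?thesis .
qed

text \<open>
  Fatou's lemma is applied to the inner and the outer integral in turn, so that almost everywhere
  convergence on \<open>M\<close> can be used in each variable separately.
\<close>

lemma kernel_energy_le_liminf:
  assumes M: "prob_space M" and [measurable]: "\<And>n. X n \<in> borel_measurable M" "Y \<in> borel_measurable M"
    and conv: "AE s in M. (\<lambda>n. X n s) \<longlonglongrightarrow> Y s"
  shows "kernel_energy V (distr M borel Y) \<le> liminf (\<lambda>n. kernel_energy V (distr M borel (X n)))"
proof -
  interpret prob_space M by fact
  have "kernel_energy V (distr M borel Y) = (\<integral>\<^sup>+ s. \<integral>\<^sup>+ t. log_kernel V (Y s) (Y t) \<partial>M \<partial>M)"
    using M by (simp add: kernel_energy_distr)
  also have "\<dots> \<le> (\<integral>\<^sup>+ s. liminf (\<lambda>n. \<integral>\<^sup>+ t. log_kernel V (X n s) (X n t) \<partial>M) \<partial>M)"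
  proof (rule nn_integral_mono_AE)
    show "AE s in M. (\<integral>\<^sup>+ t. log_kernel V (Y s) (Y t) \<partial>M)
        \<le> liminf (\<lambda>n. \<integral>\<^sup>+ t. log_kernel V (X n s) (X n t) \<partial>M)"
      using conv
    proof eventually_elim
      case (elim s)
      have "(\<integral>\<^sup>+ t. log_kernel V (Y s) (Y t) \<partial>M)
          \<le> (\<integral>\<^sup>+ t. liminf (\<lambda>n. log_kernel V (X n s) (X n t)) \<partial>M)"
        using conv elim
        by (intro nn_integral_mono_AE) (auto elim!: eventually_mono intro: lower_semicontinuous_log_kernel)
      also have "\<dots> \<le> liminf (\<lambda>n. \<integral>\<^sup>+ t. log_kernel V (X n s) (X n t) \<partial>M)"
        by (rule nn_integral_liminf) simp
      finally show ?case .
    qed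
  qed
  also have "\<dots> \<le> liminf (\<lambda>n. \<integral>\<^sup>+ s. \<integral>\<^sup>+ t. log_kernel V (X n s) (X n t) \<partial>M \<partial>M)"
    by (rule nn_integral_liminf) simp
  also have "\<dots> = liminf (\<lambda>n. kernel_energy V (distr M borel (X n)))"
    using M by (simp add: kernel_energy_distr)
  finally show ?thesis .
qed

end

locale strongly_convex_potential = confining_potential +
  fixes \<rho> :: real
  assumes \<rho>_pos: "0 < \<rho>"
    and V_strongly_convex: "\<And>\<theta> a b. \<lbrakk>0 \<le> \<theta>; \<theta> \<le> 1\<rbrakk> \<Longrightarrow>
      V ((1 - \<theta>) * a + \<theta> * b) + \<rho> / 2 * (\<theta> * (1 - \<theta>)) * (a - b)\<^sup>2 \<le> (1 - \<theta>) * V a + \<theta> * V b"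
begin

text \<open>
  The hypothesis says that the pairs \<open>(x0, y0)\<close> and \<open>(x1, y1)\<close> are ordered alike, so the two points
  do not cross on their way and their distance interpolates linearly. If one of the pairs lies on the
  diagonal then the right-hand side is infinite, which is where \<open>\<theta>\<close> has to lie strictly between \<open>0\<close> and \<open>1\<close>.
\<close>

lemma log_kernel_displacement_convex:
  assumes \<theta>: "0 < \<theta>" "\<theta> < 1"
    and order: "x0 \<le> y0 \<and> x1 \<le> y1 \<or> y0 \<le> x0 \<and> y1 \<le> x1"
  shows "log_kernel V ((1 - \<theta>) * x0 + \<theta> * x1) ((1 - \<theta>) * y0 + \<theta> * y1)
      + ennreal (\<rho> * \<theta> * (1 - \<theta>)) * (ennreal ((x0 - x1)\<^sup>2 / 4) + ennreal ((y0 - y1)\<^sup>2 / 4))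
    \<le> ennreal (1 - \<theta>) * log_kernel V x0 y0 + ennreal \<theta> * log_kernel V x1 y1"
proof (cases "x0 = y0 \<or> x1 = y1")
  case True
  then show ?thesis
    using \<theta> by (auto simp: log_kernel_def ennreal_mult_top)
next
  case False
  let ?x = "(1 - \<theta>) * x0 + \<theta> * x1" and ?y = "(1 - \<theta>) * y0 + \<theta> * y1"
  let ?kx = "(V x0 + V y0) / 2 - ln \<bar>x0 - y0\<bar>" and ?ky = "(V x1 + V y1) / 2 - ln \<bar>x1 - y1\<bar>"
  let ?kz = "(V ?x + V ?y) / 2 - ln \<bar>?x - ?y\<bar>"
  have nonneg: "0 \<le> (V x + V y) / 2 - ln \<bar>x - y\<bar>" for x y
    using max_ln_le_V[of x y] V_nonneg[of x] V_nonneg[of y] by (simp add: field_simps)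
  have dist: "\<bar>?x - ?y\<bar> = (1 - \<theta>) * \<bar>x0 - y0\<bar> + \<theta> * \<bar>x1 - y1\<bar>"
  proof -
    have eq: "?x - ?y = (1 - \<theta>) * (x0 - y0) + \<theta> * (x1 - y1)"
      by (simp add: algebra_simps)
    show ?thesis
      using order
    proof
      assume "x0 \<le> y0 \<and> x1 \<le> y1"
      then have "?x - ?y \<le> 0"
        unfolding eq using \<theta> by (intro add_nonpos_nonpos mult_nonneg_nonpos) auto
      then show ?thesis
        using \<open>x0 \<le> y0 \<and> x1 \<le> y1\<close> by (simp add: algebra_simps)
    next
      assume "y0 \<le> x0 \<and> y1 \<le> x1"
      then have "?x - ?y \<ge> 0"
        unfolding eq using \<theta> by (intro add_nonneg_nonneg mult_nonneg_nonneg) auto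
      then show ?thesis
        using \<open>y0 \<le> x0 \<and> y1 \<le> x1\<close> by (simp add: algebra_simps)
    qed
  qed
  have "(1 - \<theta>) * \<bar>x0 - y0\<bar> > 0"
    using False \<theta> by simp
  moreover have "\<theta> * \<bar>x1 - y1\<bar> > 0"
    using False \<theta> by simp
  ultimately have "?x \<noteq> ?y"
    using dist by (smt (verit))
  have ln: "(1 - \<theta>) * ln \<bar>x0 - y0\<bar> + \<theta> * ln \<bar>x1 - y1\<bar> \<le> ln \<bar>?x - ?y\<bar>"
    using concave_onD[OF ln_concave, of \<theta> "\<bar>x0 - y0\<bar>" "\<bar>x1 - y1\<bar>"] False \<theta> by (simp add: dist)
  have "?kz + \<rho> * \<theta> * (1 - \<theta>) * ((x0 - x1)\<^sup>2 / 4 + (y0 - y1)\<^sup>2 / 4) \<le> (1 - \<theta>) * ?kx + \<theta> * ?ky"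
  proof -
    have half_sum: "(A + B) / 2 - L + (p + q) / 2 \<le> (a + b) / 2 - l"
      if "A + p \<le> a" "B + q \<le> b" "l \<le> L" for A B L p q a b l :: real
      using that by (simp add: field_simps)
    have penalty: "\<rho> * \<theta> * (1 - \<theta>) * ((x0 - x1)\<^sup>2 / 4 + (y0 - y1)\<^sup>2 / 4)
      = (\<rho> / 2 * (\<theta> * (1 - \<theta>)) * (x0 - x1)\<^sup>2 + \<rho> / 2 * (\<theta> * (1 - \<theta>)) * (y0 - y1)\<^sup>2) / 2"
      by (simp add: field_simps)
    have "?kz + \<rho> * \<theta> * (1 - \<theta>) * ((x0 - x1)\<^sup>2 / 4 + (y0 - y1)\<^sup>2 / 4)
      \<le> ((1 - \<theta>) * V x0 + \<theta> * V x1 + ((1 - \<theta>) * V y0 + \<theta> * V y1)) / 2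
        - ((1 - \<theta>) * ln \<bar>x0 - y0\<bar> + \<theta> * ln \<bar>x1 - y1\<bar>)"
      unfolding penalty using \<theta> by (intro half_sum V_strongly_convex ln) auto
    also have "\<dots> = (1 - \<theta>) * ?kx + \<theta> * ?ky"
      by (simp add: field_simps)
    finally show ?thesis .
  qed
  then have "ennreal (?kz + \<rho> * \<theta> * (1 - \<theta>) * ((x0 - x1)\<^sup>2 / 4 + (y0 - y1)\<^sup>2 / 4))
      \<le> ennreal ((1 - \<theta>) * ?kx + \<theta> * ?ky)"
    by (rule ennreal_leI)
  also have "\<dots> = ennreal (1 - \<theta>) * ennreal ?kx + ennreal \<theta> * ennreal ?ky"
    using nonneg[of x0 y0] nonneg[of x1 y1] \<theta> by (simp add: ennreal_mult ennreal_plus)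
  also have "ennreal (?kz + \<rho> * \<theta> * (1 - \<theta>) * ((x0 - x1)\<^sup>2 / 4 + (y0 - y1)\<^sup>2 / 4)) =
      ennreal ?kz + ennreal (\<rho> * \<theta> * (1 - \<theta>)) * (ennreal ((x0 - x1)\<^sup>2 / 4) + ennreal ((y0 - y1)\<^sup>2 / 4))"
    using nonneg[of ?x ?y] \<theta> \<rho>_pos by (simp add: ennreal_mult ennreal_plus)
  finally show ?thesis
    using False \<open>?x \<noteq> ?y\<close> by (simp add: log_kernel_def)
qed

text \<open>
  The pointwise inequality is integrated over the square \<open>(0, 1)\<^sup>2\<close>; monotonicity of both quantile
  functions makes any two parameters \<open>s\<close>, \<open>t\<close> ordered alike.
\<close>

lemma kernel_energy_displacement_convex:
  assumes \<theta>: "0 < \<theta>" "\<theta> < 1"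
    and X [measurable]: "X \<in> borel_measurable unit_interval_measure" "mono_on {0<..<1} X"
    and Y [measurable]: "Y \<in> borel_measurable unit_interval_measure" "mono_on {0<..<1} Y"
  shows "kernel_energy V (distr unit_interval_measure borel (\<lambda>s. (1 - \<theta>) * X s + \<theta> * Y s))
      + ennreal (\<rho> * \<theta> * (1 - \<theta>)) * (\<integral>\<^sup>+ s. ennreal (1 / 2 * (X s - Y s)\<^sup>2) \<partial>unit_interval_measure)
    \<le> ennreal (1 - \<theta>) * kernel_energy V (distr unit_interval_measure borel X)
      + ennreal \<theta> * kernel_energy V (distr unit_interval_measure borel Y)"
proof -
  let ?U = unit_interval_measure
  interpret U: prob_space ?U by (rule prob_space_unit_interval)
  let ?Z = "\<lambda>s. (1 - \<theta>) * X s + \<theta> * Y s"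
  let ?D = "\<lambda>s. ennreal ((X s - Y s)\<^sup>2 / 4)"
  define E where "E = (\<lambda>s t. ?D s + ?D t)"
  have [measurable]: "E s \<in> borel_measurable ?U" "(\<lambda>s. \<integral>\<^sup>+ t. E s t \<partial>?U) \<in> borel_measurable ?U" for s
    unfolding E_def by measurable
  have cost: "(\<integral>\<^sup>+ s. \<integral>\<^sup>+ t. E s t \<partial>?U \<partial>?U) = (\<integral>\<^sup>+ s. ennreal (1 / 2 * (X s - Y s)\<^sup>2) \<partial>?U)"
  proof -
    have "(\<integral>\<^sup>+ s. \<integral>\<^sup>+ t. E s t \<partial>?U \<partial>?U) = (\<integral>\<^sup>+ s. ?D s \<partial>?U) + (\<integral>\<^sup>+ s. ?D s \<partial>?U)"
      using U.emeasure_space_1 by (simp add: E_def nn_integral_add)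
    also have "\<dots> = (\<integral>\<^sup>+ s. ?D s + ?D s \<partial>?U)"
      by (rule nn_integral_add[symmetric]) measurable
    finally show ?thesis
      by (simp flip: ennreal_plus)
  qed
  have "kernel_energy V (distr ?U borel ?Z)
      + ennreal (\<rho> * \<theta> * (1 - \<theta>)) * (\<integral>\<^sup>+ s. ennreal (1 / 2 * (X s - Y s)\<^sup>2) \<partial>?U)
    = (\<integral>\<^sup>+ s. \<integral>\<^sup>+ t. log_kernel V (?Z s) (?Z t) + ennreal (\<rho> * \<theta> * (1 - \<theta>)) * E s t \<partial>?U \<partial>?U)"
    unfolding cost[symmetric] using prob_space_unit_interval
    by (simp add: kernel_energy_distr nn_integral_add nn_integral_cmult)
  also have "\<dots> \<le> (\<integral>\<^sup>+ s. \<integral>\<^sup>+ t. ennreal (1 - \<theta>) * log_kernel V (X s) (X t)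
      + ennreal \<theta> * log_kernel V (Y s) (Y t) \<partial>?U \<partial>?U)"
    unfolding E_def
  proof (intro nn_integral_mono log_kernel_displacement_convex \<theta>)
    fix s t assume "s \<in> space ?U" "t \<in> space ?U"
    then have "s \<in> {0<..<1}" "t \<in> {0<..<1}"
      by (simp_all add: space_restrict_space)
    then show "X s \<le> X t \<and> Y s \<le> Y t \<or> X t \<le> X s \<and> Y t \<le> Y s"
      using X(2) Y(2) by (metis linear mono_onD)
  qed
  also have "\<dots> = ennreal (1 - \<theta>) * kernel_energy V (distr ?U borel X)
      + ennreal \<theta> * kernel_energy V (distr ?U borel Y)"
    using prob_space_unit_interval
    by (simp add: kernel_energy_distr nn_integral_add nn_integral_cmult)
  finally show ?thesis .
qed

section \<open>Minimizers of the energy\<close>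

text \<open>
  The transport inequality itself: the energy exceeds its minimum by at least \<open>\<rho>\<close> times the cost of
  the monotone coupling with the minimizer.
\<close>

lemma kernel_energy_minimizer_gap:
  assumes \<nu>: "\<nu> \<in> borel_probs" and min: "\<And>\<nu>'. \<nu>' \<in> borel_probs \<Longrightarrow> kernel_energy V \<nu> \<le> kernel_energy V \<nu>'"
    and X: "X \<in> borel_measurable unit_interval_measure" "mono_on {0<..<1} X"
      "distr unit_interval_measure borel X = \<nu>"
    and Y: "Y \<in> borel_measurable unit_interval_measure" "mono_on {0<..<1} Y"
      "distr unit_interval_measure borel Y = \<mu>"
  shows "kernel_energy V \<nu>
      + ennreal \<rho> * (\<integral>\<^sup>+ s. ennreal (1 / 2 * (X s - Y s)\<^sup>2) \<partial>unit_interval_measure)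
    \<le> kernel_energy V \<mu>"
proof (cases "kernel_energy V \<mu>")
  case (real g)
  define d where "d = (\<integral>\<^sup>+ s. ennreal (1 / 2 * (X s - Y s)\<^sup>2) \<partial>unit_interval_measure)"
  have "\<mu> \<in> borel_probs"
    using distr_in_borel_probs[OF prob_space_unit_interval Y(1)] Y(3) by simp
  then obtain f where f: "kernel_energy V \<nu> = ennreal f" "f \<ge> 0"
    using min[of \<mu>] real by (cases "kernel_energy V \<nu>") (auto simp: top_unique)
  have gap: "ennreal f + ennreal (\<rho> * \<theta> * (1 - \<theta>)) * d \<le> ennreal ((1 - \<theta>) * f + \<theta> * g)"
    if \<theta>: "0 < \<theta>" "\<theta> < 1" for \<theta>
  proof -
    let ?Z = "\<lambda>s. (1 - \<theta>) * X s + \<theta> * Y s"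
    note [measurable] = X(1) Y(1)
    have "distr unit_interval_measure borel ?Z \<in> borel_probs"
      by (intro distr_in_borel_probs prob_space_unit_interval) simp
    then have "ennreal f \<le> kernel_energy V (distr unit_interval_measure borel ?Z)"
      using min f by metis
    then have "ennreal f + ennreal (\<rho> * \<theta> * (1 - \<theta>)) * d
        \<le> ennreal (1 - \<theta>) * ennreal f + ennreal \<theta> * ennreal g"
      using kernel_energy_displacement_convex[OF \<theta> X(1,2) Y(1,2)]
      unfolding X(3) Y(3) f(1) real(2) d_def by (meson add_right_mono order_trans)
    then show ?thesis
      using \<theta> f real by (simp add: ennreal_mult ennreal_plus)
  qed
  have "d \<noteq> \<infinity>"
  proof
    assume "d = \<infinity>"
    then show False
      using gap[of "1 / 2"] \<rho>_pos by (simp add: ennreal_mult_top top_unique)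
  qed
  then obtain r where r: "d = ennreal r" "r \<ge> 0"
    by (cases d) auto
  \<comment> \<open>The limit \<open>\<theta> \<rightarrow> 0\<close> removes the factor \<open>z = 1 - \<theta>\<close>.\<close>
  have "\<rho> * r \<le> g - f"
  proof (rule field_le_mult_one_interval)
    fix z :: real assume z: "0 < z" "z < 1"
    have "ennreal (f + \<rho> * (1 - z) * z * r) \<le> ennreal (z * f + (1 - z) * g)"
      using gap[of "1 - z"] z f r \<rho>_pos by (simp add: ennreal_mult ennreal_plus)
    then have "f + \<rho> * (1 - z) * z * r \<le> z * f + (1 - z) * g"
      using z f real by (subst (asm) ennreal_le_iff) (auto intro!: add_nonneg_nonneg mult_nonneg_nonneg)
    then have "(1 - z) * (z * (\<rho> * r)) \<le> (1 - z) * (g - f)"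
      by (simp add: algebra_simps)
    then show "z * (\<rho> * r) \<le> g - f"
      using z by simp
  qed
  then have "ennreal (f + \<rho> * r) \<le> ennreal g"
    by (intro ennreal_leI) simp
  then show ?thesis
    unfolding d_def[symmetric] using f r real \<rho>_pos by (simp add: ennreal_mult ennreal_plus)
qed simp

lemma kernel_energy_minimizer_unique:
  assumes \<nu>: "\<nu> \<in> borel_probs" and min: "\<And>\<nu>'. \<nu>' \<in> borel_probs \<Longrightarrow> kernel_energy V \<nu> \<le> kernel_energy V \<nu>'"
    and \<mu>: "\<mu> \<in> borel_probs" and le: "kernel_energy V \<mu> \<le> kernel_energy V \<nu>"
    and finite: "kernel_energy V \<nu> \<noteq> \<infinity>"
  shows "\<mu> = \<nu>"
proof -
  let ?U = unit_interval_measure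
  obtain X where X [measurable]: "X \<in> borel_measurable ?U" "mono_on {0<..<1} X" "distr ?U borel X = \<nu>"
    using quantile_function[OF \<nu>] .
  obtain Y where Y [measurable]: "Y \<in> borel_measurable ?U" "mono_on {0<..<1} Y" "distr ?U borel Y = \<mu>"
    using quantile_function[OF \<mu>] .
  have "kernel_energy V \<nu> + ennreal \<rho> * (\<integral>\<^sup>+ s. ennreal (1 / 2 * (X s - Y s)\<^sup>2) \<partial>?U) \<le> kernel_energy V \<nu> + 0"
    using order_trans[OF kernel_energy_minimizer_gap[OF \<nu> min X Y] le] by simp
  then have "ennreal \<rho> * (\<integral>\<^sup>+ s. ennreal (1 / 2 * (X s - Y s)\<^sup>2) \<partial>?U) = 0"
    using finite by (subst (asm) ennreal_add_left_cancel_le) auto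
  then have "(\<integral>\<^sup>+ s. ennreal (1 / 2 * (X s - Y s)\<^sup>2) \<partial>?U) = 0"
    using \<rho>_pos by simp
  then have "AE s in ?U. Y s = X s"
    by (subst (asm) nn_integral_0_iff_AE) (auto simp: ennreal_eq_0_iff)
  then have "distr ?U borel Y = distr ?U borel X"
    by (intro distr_cong_AE) auto
  then show ?thesis
    using X(3) Y(3) by simp
qed

text \<open>
  A minimizing sequence is chosen so fast, with excess energy \<open>\<rho> / 4 * (1 / 4) ^ n\<close>, that consecutive
  quantile functions differ by \<open>O((1 / 2) ^ n)\<close> in \<open>L\<^sup>2\<close> and thus converge almost everywhere. The
  limit enters only through its law, whose energy Fatou's lemma bounds by the infimum.
\<close>

lemma kernel_energy_minimizer_exists:
  assumes \<nu>\<^sub>0: "\<nu>\<^sub>0 \<in> borel_probs" "kernel_energy V \<nu>\<^sub>0 \<noteq> \<infinity>"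
  obtains \<nu> where "\<nu> \<in> borel_probs" "\<And>\<nu>'. \<nu>' \<in> borel_probs \<Longrightarrow> kernel_energy V \<nu> \<le> kernel_energy V \<nu>'"
proof -
  let ?U = unit_interval_measure
  interpret U: prob_space ?U by (rule prob_space_unit_interval)
  define m where "m = (INF \<nu>\<in>borel_probs. kernel_energy V \<nu>)"
  define \<delta> where "\<delta> = (\<lambda>n :: nat. ennreal (\<rho> / 4) * ennreal ((1 / 4) ^ n))"
  have m_le: "m \<le> kernel_energy V \<nu>" if "\<nu> \<in> borel_probs" for \<nu>
    using that by (simp add: m_def INF_lower)
  have m_finite: "m \<noteq> \<infinity>"
    using m_le[OF \<nu>\<^sub>0(1)] \<nu>\<^sub>0(2) by (auto simp: top_unique)
  have "\<exists>X. X \<in> borel_measurable ?U \<and> mono_on {0<..<1} X \<and> kernel_energy V (distr ?U borel X) \<le> m + \<delta> n" for n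
  proof -
    have "\<delta> n \<noteq> 0"
      using \<rho>_pos by (simp add: \<delta>_def)
    then have "m < m + \<delta> n"
      using m_finite ennreal_add_left_cancel_less[of m 0 "\<delta> n"] by (simp add: zero_less_iff_neq_zero)
    then obtain \<nu> where "\<nu> \<in> borel_probs" "kernel_energy V \<nu> < m + \<delta> n"
      unfolding m_def INF_less_iff by blast
    then show ?thesis
      by (metis less_imp_le quantile_function)
  qed
  then obtain X where X [measurable]: "\<And>n. X n \<in> borel_measurable ?U" and mono: "\<And>n. mono_on {0<..<1} (X n)"
    and X_le: "\<And>n. kernel_energy V (distr ?U borel (X n)) \<le> m + \<delta> n"
    by metis
  \<comment> \<open>The law of the midpoint has energy at least \<open>m\<close>, so displacement convexity at \<open>\<theta> = 1 / 2\<close>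
    leaves only the excess energy \<open>\<delta> n\<close> to pay for the cost.\<close>
  have cost: "(\<integral>\<^sup>+ s. ennreal (1 / 2 * (X n s - X (Suc n) s)\<^sup>2) \<partial>?U) \<le> ennreal ((1 / 4) ^ n)" for n
  proof -
    let ?d = "\<integral>\<^sup>+ s. ennreal (1 / 2 * (X n s - X (Suc n) s)\<^sup>2) \<partial>?U"
    let ?Z = "\<lambda>s. (1 - 1 / 2) * X n s + 1 / 2 * X (Suc n) s"
    have "\<delta> (Suc n) \<le> \<delta> n"
      unfolding \<delta>_def by (intro mult_left_mono ennreal_leI) auto
    then have Suc_le: "kernel_energy V (distr ?U borel (X (Suc n))) \<le> m + \<delta> n"
      using X_le[of "Suc n"] by (meson add_left_mono order_trans)
    have "m + ennreal (\<rho> * (1 / 2) * (1 - 1 / 2)) * ?d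
        \<le> kernel_energy V (distr ?U borel ?Z) + ennreal (\<rho> * (1 / 2) * (1 - 1 / 2)) * ?d"
      by (intro add_right_mono m_le distr_in_borel_probs prob_space_unit_interval) simp
    also have "\<dots> \<le> ennreal (1 - 1 / 2) * kernel_energy V (distr ?U borel (X n))
        + ennreal (1 / 2) * kernel_energy V (distr ?U borel (X (Suc n)))"
      by (rule kernel_energy_displacement_convex) (simp_all add: mono X)
    also have "\<dots> \<le> ennreal (1 - 1 / 2) * (m + \<delta> n) + ennreal (1 / 2) * (m + \<delta> n)"
      by (intro add_mono mult_left_mono X_le Suc_le) auto
    also have "\<dots> = (ennreal (1 - 1 / 2) + ennreal (1 / 2)) * (m + \<delta> n)"
      by (rule distrib_right[symmetric])
    also have "ennreal (1 - 1 / 2) + ennreal (1 / 2) = 1"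
      by (subst ennreal_plus[symmetric]) auto
    finally have "ennreal (\<rho> / 4) * ?d \<le> ennreal (\<rho> / 4) * ennreal ((1 / 4) ^ n)"
      using m_finite by (simp add: \<delta>_def)
    then show ?thesis
      using \<rho>_pos by (subst (asm) ennreal_mult_le_mult_iff) auto
  qed
  \<comment> \<open>The weighted inequality \<open>\<bar>D\<bar> \<le> (2 ^ n * D\<^sup>2 + (1 / 2) ^ n) / 2\<close> passes from \<open>L\<^sup>2\<close> to \<open>L\<^sup>1\<close>.\<close>
  have increment: "(\<integral>\<^sup>+ s. ennreal \<bar>X (Suc n) s - X n s\<bar> \<partial>?U) \<le> ennreal (2 * (1 / 2) ^ n)" for n
  proof -
    have "ennreal \<bar>X (Suc n) s - X n s\<bar>
        \<le> ennreal (2 ^ n) * ennreal (1 / 2 * (X n s - X (Suc n) s)\<^sup>2) + ennreal ((1 / 2) ^ n)" for s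
    proof -
      let ?D = "X n s - X (Suc n) s"
      have "0 \<le> 2 ^ n * (\<bar>?D\<bar> - (1 / 2) ^ n)\<^sup>2"
        by simp
      also have "\<dots> = 2 ^ n * ?D\<^sup>2 - 2 * \<bar>?D\<bar> + (1 / 2) ^ n"
        by (simp add: power2_eq_square algebra_simps power_one_over)
      finally have sq: "0 \<le> 2 ^ n * ?D\<^sup>2 - 2 * \<bar>?D\<bar> + (1 / 2) ^ n" .
      have "a \<le> p / 2 + h" if "0 \<le> p - 2 * a + h" "0 \<le> h" for a p h :: real
        using that by simp
      from this[OF sq] have "\<bar>X (Suc n) s - X n s\<bar> \<le> 2 ^ n * (1 / 2 * ?D\<^sup>2) + (1 / 2) ^ n"
        by (simp add: abs_minus_commute)
      then have "ennreal \<bar>X (Suc n) s - X n s\<bar> \<le> ennreal (2 ^ n * (1 / 2 * ?D\<^sup>2) + (1 / 2) ^ n)"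
        by (rule ennreal_leI)
      also have "\<dots> = ennreal (2 ^ n * (1 / 2 * ?D\<^sup>2)) + ennreal ((1 / 2) ^ n)"
        by (rule ennreal_plus) auto
      also have "ennreal (2 ^ n * (1 / 2 * ?D\<^sup>2)) = ennreal (2 ^ n) * ennreal (1 / 2 * ?D\<^sup>2)"
        by (rule ennreal_mult) auto
      finally show ?thesis .
    qed
    then have "(\<integral>\<^sup>+ s. ennreal \<bar>X (Suc n) s - X n s\<bar> \<partial>?U)
        \<le> (\<integral>\<^sup>+ s. ennreal (2 ^ n) * ennreal (1 / 2 * (X n s - X (Suc n) s)\<^sup>2) + ennreal ((1 / 2) ^ n) \<partial>?U)"
      by (intro nn_integral_mono)
    also have "\<dots> = ennreal (2 ^ n) * (\<integral>\<^sup>+ s. ennreal (1 / 2 * (X n s - X (Suc n) s)\<^sup>2) \<partial>?U) + ennreal ((1 / 2) ^ n)"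
      using U.emeasure_space_1 by (subst nn_integral_add) (auto simp: nn_integral_cmult)
    also have "\<dots> \<le> ennreal (2 ^ n) * ennreal ((1 / 4) ^ n) + ennreal ((1 / 2) ^ n)"
      by (intro add_right_mono mult_left_mono cost) simp
    also have "\<dots> = ennreal (2 ^ n * (1 / 4) ^ n + (1 / 2) ^ n)"
      by (subst ennreal_mult[symmetric]; simp add: ennreal_plus)
    also have "2 ^ n * (1 / 4) ^ n + (1 / 2) ^ n = 2 * (1 / 2 :: real) ^ n"
      by (simp flip: power_mult_distrib)
    finally show ?thesis .
  qed
  have "(\<Sum>n. \<integral>\<^sup>+ s. ennreal \<bar>X (Suc n) s - X n s\<bar> \<partial>?U) \<le> (\<Sum>n. ennreal (2 * (1 / 2) ^ n))"
    by (intro suminf_le increment) auto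
  also have "\<dots> = ennreal 4"
    using sums_mult[OF geometric_sums[of "1 / 2 :: real"], of 2] by (intro suminf_ennreal_eq) auto
  finally have "AE s in ?U. convergent (\<lambda>n. X n s)"
    by (intro AE_convergent_if_summable_increments) (auto simp: top_unique)
  then have conv: "AE s in ?U. (\<lambda>n. X n s) \<longlonglongrightarrow> lim (\<lambda>n. X n s)"
    by (simp add: convergent_LIMSEQ_iff)
  have lim [measurable]: "(\<lambda>s. lim (\<lambda>n. X n s)) \<in> borel_measurable ?U"
    by measurable
  let ?\<nu> = "distr ?U borel (\<lambda>s. lim (\<lambda>n. X n s))"
  have "kernel_energy V ?\<nu> \<le> liminf (\<lambda>n. kernel_energy V (distr ?U borel (X n)))"
    by (rule kernel_energy_le_liminf[OF prob_space_unit_interval X lim conv])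
  also have "\<dots> \<le> liminf (\<lambda>n. m + \<delta> n)"
    by (intro Liminf_mono always_eventually allI X_le)
  also have "\<dots> = m"
  proof -
    have eq: "\<delta> = (\<lambda>n. ennreal (\<rho> / 4 * (1 / 4) ^ n))"
      unfolding \<delta>_def using \<rho>_pos by (intro ext ennreal_mult[symmetric]) auto
    have "(\<lambda>n. ennreal (\<rho> / 4 * (1 / 4) ^ n)) \<longlonglongrightarrow> ennreal (\<rho> / 4 * 0)"
      by (intro tendsto_ennrealI tendsto_mult tendsto_const LIMSEQ_power_zero) simp
    then have "\<delta> \<longlonglongrightarrow> 0"
      by (simp add: eq)
    then have "(\<lambda>n. m + \<delta> n) \<longlonglongrightarrow> m + 0"
      by (intro tendsto_add tendsto_const)
    then show ?thesis
      by (intro lim_imp_Liminf) simp_all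
  qed
  finally have "kernel_energy V ?\<nu> \<le> m" .
  then show thesis
    by (intro that[of ?\<nu>] distr_in_borel_probs prob_space_unit_interval lim) (meson m_le order_trans)
qed

end

section \<open>The transport inequality for the equilibrium measure\<close>

theorem theorem4p5:
  fixes Q :: "real \<Rightarrow> real" and \<rho> :: real and \<mu> :: "real measure"
  assumes "\<rho> > 0"
    and "convex_on UNIV (\<lambda>x. Q x - \<rho> / 2 * x\<^sup>2)"
    and "\<mu> \<in> borel_probs"
    and "compactly_supported \<mu>"
  shows "wasserstein \<mu> (equilibrium_measure Q)
           \<le> ereal_sqrt (ereal (1 / \<rho>) * rel_free_entropy Q \<mu>)"
proof -
  obtain c\<^sub>0 where c\<^sub>0: "\<And>x. 4 * \<bar>x\<bar> \<le> Q x + c\<^sub>0"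
    using strongly_convex_coercive[OF assms(1,2)] by blast
  \<comment> \<open>A nonnegative shift is needed to bound the negative part of \<open>Q = V - c\<close> by \<open>c\<close>.\<close>
  define c where "c = max 0 c\<^sub>0"
  define V where "V = (\<lambda>x. Q x + c)"
  have "continuous_on UNIV (\<lambda>x. (Q x - \<rho> / 2 * x\<^sup>2) + (\<rho> / 2 * x\<^sup>2 + c))"
    by (intro continuous_on_add convex_on_continuous assms(2) continuous_intros) simp
  then have "continuous_on UNIV V"
    by (simp add: V_def add_ac)
  moreover have "4 * \<bar>x\<bar> \<le> V x" for x
    using c\<^sub>0[of x] by (simp add: V_def c_def)
  moreover have "V ((1 - \<theta>) * a + \<theta> * b) + \<rho> / 2 * (\<theta> * (1 - \<theta>)) * (a - b)\<^sup>2 \<le> (1 - \<theta>) * V a + \<theta> * V b"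
    if "0 \<le> \<theta>" "\<theta> \<le> 1" for \<theta> a b
    using strongly_convex_ineq[OF assms(2) that, of a b] by (simp add: V_def algebra_simps)
  ultimately interpret strongly_convex_potential V \<rho>
    using \<open>\<rho> > 0\<close> by unfold_locales
  have energy: "weighted_energy Q \<nu> = enn2ereal (kernel_energy V \<nu>) - ereal c" if "\<nu> \<in> borel_probs" for \<nu>
    using weighted_energy_eq_kernel_energy[OF that, of c] by (simp add: V_def c_def)
  have rel: "rel_free_entropy Q \<mu> = weighted_energy Q \<mu> - weighted_energy Q (equilibrium_measure Q)"
    by (simp add: rel_free_entropy_def energy_constant_def weighted_energy_def minus_ereal_def)
  show ?thesis
  proof (cases "kernel_energy V \<mu>")
    case top
    then have "rel_free_entropy Q \<mu> = \<infinity>"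
      using energy[OF assms(3)] by (simp add: rel)
    then show ?thesis
      using \<open>\<rho> > 0\<close> by (simp add: ereal_sqrt_def)
  next
    case (real g)
    obtain \<nu> where \<nu>: "\<nu> \<in> borel_probs" "\<And>\<nu>'. \<nu>' \<in> borel_probs \<Longrightarrow> kernel_energy V \<nu> \<le> kernel_energy V \<nu>'"
      using kernel_energy_minimizer_exists[OF assms(3)] real by auto
    obtain f where f: "kernel_energy V \<nu> = ennreal f" "f \<ge> 0"
      using \<nu>(2)[OF assms(3)] real by (cases "kernel_energy V \<nu>") (auto simp: top_unique)
    have energy_le: "weighted_energy Q \<nu>\<^sub>1 \<le> weighted_energy Q \<nu>\<^sub>2 \<longleftrightarrow> kernel_energy V \<nu>\<^sub>1 \<le> kernel_energy V \<nu>\<^sub>2"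
      if "\<nu>\<^sub>1 \<in> borel_probs" "\<nu>\<^sub>2 \<in> borel_probs" for \<nu>\<^sub>1 \<nu>\<^sub>2
      by (cases "kernel_energy V \<nu>\<^sub>1"; cases "kernel_energy V \<nu>\<^sub>2") (simp_all add: energy that top_unique)
    have eq: "equilibrium_measure Q = \<nu>"
      unfolding equilibrium_measure_def
    proof (rule the_equality)
      show "\<nu> \<in> borel_probs \<and> (\<forall>\<nu>'\<in>borel_probs. weighted_energy Q \<nu> \<le> weighted_energy Q \<nu>')"
        using \<nu> by (simp add: energy_le)
    next
      fix \<nu>' assume "\<nu>' \<in> borel_probs \<and> (\<forall>\<nu>\<in>borel_probs. weighted_energy Q \<nu>' \<le> weighted_energy Q \<nu>)"
      then have "\<nu>' \<in> borel_probs" "kernel_energy V \<nu>' \<le> kernel_energy V \<nu>"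
        using \<nu>(1) energy_le by blast+
      then show "\<nu>' = \<nu>"
        using kernel_energy_minimizer_unique[OF \<nu>] f by auto
    qed
    let ?U = unit_interval_measure
    obtain X where X: "X \<in> borel_measurable ?U" "mono_on {0<..<1} X" "distr ?U borel X = \<nu>"
      using quantile_function[OF \<nu>(1)] .
    obtain Y where Y: "Y \<in> borel_measurable ?U" "mono_on {0<..<1} Y" "distr ?U borel Y = \<mu>"
      using quantile_function[OF assms(3)] .
    let ?d = "\<integral>\<^sup>+ s. ennreal (1 / 2 * (X s - Y s)\<^sup>2) \<partial>?U"
    have gap: "ennreal f + ennreal \<rho> * ?d \<le> ennreal g"
      using kernel_energy_minimizer_gap[OF \<nu> X Y] f real by simp
    then have "?d \<noteq> \<infinity>"
      using \<open>\<rho> > 0\<close> by (auto simp: ennreal_mult_top top_unique)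
    then obtain r where r: "?d = ennreal r" "r \<ge> 0"
      by (cases ?d) auto
    have "f + \<rho> * r \<le> g"
      using gap f r real \<open>\<rho> > 0\<close> by (simp flip: ennreal_mult ennreal_plus)
    then have r_le: "r \<le> 1 / \<rho> * (g - f)"
      using \<open>\<rho> > 0\<close> by (simp add: field_simps)
    have "wasserstein \<mu> \<nu> \<le> ereal_sqrt (enn2ereal (\<integral>\<^sup>+ s. ennreal (1 / 2 * (Y s - X s)\<^sup>2) \<partial>?U))"
      using wasserstein_le_transport_cost[OF prob_space_unit_interval Y(1) X(1)] X(3) Y(3) by simp
    also have "\<dots> = ereal_sqrt (ereal r)"
      using r by (simp add: power2_commute)
    also have "\<dots> \<le> ereal_sqrt (ereal (1 / \<rho> * (g - f)))"
      using r r_le by (intro ereal_sqrt_mono) auto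
    also have "ereal (1 / \<rho> * (g - f)) = ereal (1 / \<rho>) * rel_free_entropy Q \<mu>"
      using f real energy[OF assms(3)] energy[OF \<nu>(1)] by (simp add: rel eq)
    finally show ?thesis
      by (simp add: eq)
  qed
qed

end
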